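(* The simplicial complex $\Delta_{12,33}$ (defined in the context) is not a suspension and it has no contractible edge.
   Context: Simplicial complexes are finite abstract simplicial complexes; faces are written as strings of vertices (e.g. $x_1x_2y_3=\{x_1,x_2,y_3\}$), and $\langle F_1,\dots,F_k\rangle$ is the complex whose facets (inclusion-maximal faces) are $F_1,\dots,F_k$. The join is $\Delta*\Gamma=\{F\cup G: F\in\Delta, G\in\Gamma\}$, and $\{v\}*\Delta:=\Delta*\langle\{v\}\rangle$ is the cone. A complex is a suspension if it equals $\Delta*\langle\{v\},\{w\}\rangle$ for some simplicial complex $\Delta$ and two distinct vertices $v,w$ not in $\Delta$. For a subset $W$ of the vertex set, the induced subcomplex is $\Delta[W]=\{F\in\Delta: F\subseteq W\}$. An edge of a complex $\Delta$ is contractible if it is not contained in any induced $4$-cycle of $\Delta$, i.e. in any induced subcomplex isomorphic to a $4$-cycle. For distinct elements $p_1,p_2,p_3,q_1,q_2,q_3$ put $$\Diamond([p_1,p_2,p_3],[q_1,q_2,q_3])=\langle\{p_1\},\{q_1\}\rangle*\langle\{p_2\},\{q_2\}\rangle*\langle\{p_3\},\{q_3\}\rangle,$$ an octahedral $2$-sphere in which $p_i$ and $q_i$ are non-adjacent for each $i$. Definition of $\Delta_{12,33}$: the vertex set is $\{x_1,x_2,x_3,y_1,y_2,y_3,z_1,z_2,z_3,v_1,v_2,v_3\}$ ($12$ distinct elements) and $\Delta_{12,33}=\Gamma_1\cup\Gamma_2$, where $$\Gamma_1=\{v_1\}*\Diamond([x_1,x_2,x_3],[y_1,y_2,y_3])\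 \cup\ \{v_2\}*\Diamond([y_1,y_2,y_3],[z_1,z_2,z_3])\ \cup\ \{v_3\}*\Diamond([x_1,x_2,x_3],[z_3,z_1,z_2])$$ (contributing $24$ facets) and $$\Gamma_2=\langle x_1x_2y_3z_2,\ x_2y_1y_3z_2,\ x_2y_1z_2z_3,\ x_2x_3y_1z_3,\ x_3y_1y_2z_3,\ x_3y_2z_1z_3,\ x_1x_3y_2z_1,\ x_1y_2y_3z_1,\ x_1y_3z_1z_2\rangle$$ (contributing $9$ facets). *)

theory Defs
  imports Main
begin

text \<open>A simplicial complex is represented by its set of faces; its vertex set is the union of
  the faces. As usual, the empty set is a face of every complex.\<close>

definition simplicial_complex :: "'a set set \<Rightarrow> bool" where
  "simplicial_complex \<Delta> \<longleftrightarrow>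
     finite \<Delta> \<and> (\<forall>F\<in>\<Delta>. finite F) \<and> {} \<in> \<Delta> \<and> (\<forall>F\<in>\<Delta>. \<forall>G. G \<subseteq> F \<longrightarrow> G \<in> \<Delta>)"

definition vertices :: "'a set set \<Rightarrow> 'a set" where
  "vertices \<Delta> = \<Union>\<Delta>"

definition generated :: "'a set set \<Rightarrow> 'a set set" where
  "generated S = {F. \<exists>G\<in>S. F \<subseteq> G}"

definition join :: "'a set set \<Rightarrow> 'a set set \<Rightarrow> 'a set set" where
  "join \<Delta> \<Gamma> = {F \<union> G | F G. F \<in> \<Delta> \<and> G \<in> \<Gamma>}"

definition cone :: "'a \<Rightarrow> 'a set set \<Rightarrow> 'a set set" where
  "cone v \<Delta> = join \<Delta> (generated {{v}})"

definition is_suspension :: "'a set set \<Rightarrow> bool" where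
  "is_suspension \<Delta> \<longleftrightarrow>
     (\<exists>\<Gamma> v w. simplicial_complex \<Gamma> \<and> v \<noteq> w \<and> v \<notin> vertices \<Gamma> \<and> w \<notin> vertices \<Gamma> \<and>
        \<Delta> = join \<Gamma> (generated {{v}, {w}}))"

definition induced :: "'a set set \<Rightarrow> 'a set \<Rightarrow> 'a set set" where
  "induced \<Delta> W = {F \<in> \<Delta>. F \<subseteq> W}"

definition isomorphic :: "'a set set \<Rightarrow> 'b set set \<Rightarrow> bool" where
  "isomorphic \<Delta> \<Gamma> \<longleftrightarrow>
     (\<exists>f. bij_betw f (vertices \<Delta>) (vertices \<Gamma>) \<and> (\<lambda>F. f ` F) ` \<Delta> = \<Gamma>)"

definition four_cycle :: "nat set set" where
  "four_cycle = generated {{0, 1}, {1, 2}, {2, 3}, {3, 0}}"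

definition is_edge :: "'a set set \<Rightarrow> 'a set \<Rightarrow> bool" where
  "is_edge \<Delta> e \<longleftrightarrow> e \<in> \<Delta> \<and> card e = 2"

definition contractible_edge :: "'a set set \<Rightarrow> 'a set \<Rightarrow> bool" where
  "contractible_edge \<Delta> e \<longleftrightarrow>
     is_edge \<Delta> e \<and>
     \<not> (\<exists>W \<subseteq> vertices \<Delta>. isomorphic (induced \<Delta> W) four_cycle \<and> e \<in> induced \<Delta> W)"

fun diamond :: "'a \<times> 'a \<times> 'a \<Rightarrow> 'a \<times> 'a \<times> 'a \<Rightarrow> 'a set set" where
  "diamond (p1, p2, p3) (q1, q2, q3) =
     join (join (generated {{p1}, {q1}}) (generated {{p2}, {q2}})) (generated {{p3}, {q3}})"

datatype vertex = X1 | X2 | X3 | Y1 | Y2 | Y3 | Z1 | Z2 | Z3 | V1 | V2 | V3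

definition Gamma1 :: "vertex set set" where
  "Gamma1 =
     cone V1 (diamond (X1, X2, X3) (Y1, Y2, Y3)) \<union>
     cone V2 (diamond (Y1, Y2, Y3) (Z1, Z2, Z3)) \<union>
     cone V3 (diamond (X1, X2, X3) (Z3, Z1, Z2))"

definition Gamma2 :: "vertex set set" where
  "Gamma2 = generated
     {{X1, X2, Y3, Z2}, {X2, Y1, Y3, Z2}, {X2, Y1, Z2, Z3},
      {X2, X3, Y1, Z3}, {X3, Y1, Y2, Z3}, {X3, Y2, Z1, Z3},
      {X1, X3, Y2, Z1}, {X1, Y2, Y3, Z1}, {X1, Y3, Z1, Z2}}"

definition Delta_12_33 :: "vertex set set" where
  "Delta_12_33 = Gamma1 \<union> Gamma2"

end

theory Submission
  imports Defs
begin

text \<open>All checks take place in the graph of non-adjacent pairs of vertices. A suspension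
  point is non-adjacent to at most one other vertex, but every vertex of the complex has at least
  three non-neighbours. For an edge \<open>ab\<close>, a non-neighbour \<open>c\<close> of \<open>a\<close> and a non-neighbour \<open>d\<close> of
  \<open>b\<close> can be chosen such that \<open>bc\<close>, \<open>cd\<close> and \<open>da\<close> are edges, and then \<open>abcd\<close> is an induced
  4-cycle.\<close>

text \<open>Lets every join and cone in the complex be expanded into an explicit list of generating
  faces. A set \<open>H\<close> below \<open>F \<union> G\<close> splits into
  \<open>H \<inter> F\<close> and \<open>H \<inter> G\<close>.\<close>

lemma join_generated:
  "join (generated A) (generated B) = generated (\<Union>F\<in>A. (\<lambda>G. F \<union> G) ` B)"
proof (intro subset_antisym subsetI)
  fix H assume "H \<in> join (generated A) (generated B)"
  then obtain F G F' G' where "H = F' \<union> G'" "F' \<subseteq> F" "F \<in> A" "G' \<subseteq> G" "G \<in> B"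
    unfolding join_def generated_def by blast
  then have "H \<subseteq> F \<union> G" by blast
  with \<open>F \<in> A\<close> \<open>G \<in> B\<close> show "H \<in> generated (\<Union>F\<in>A. (\<lambda>G. F \<union> G) ` B)"
    unfolding generated_def by blast
next
  fix H assume "H \<in> generated (\<Union>F\<in>A. (\<lambda>G. F \<union> G) ` B)"
  then obtain F G where FG: "H \<subseteq> F \<union> G" "F \<in> A" "G \<in> B"
    unfolding generated_def by blast
  then have "H = (H \<inter> F) \<union> (H \<inter> G)" by blast
  moreover have "H \<inter> F \<in> generated A" "H \<inter> G \<in> generated B"
    using FG unfolding generated_def by blast+
  ultimately show "H \<in> join (generated A) (generated B)"
    unfolding join_def by blast
qed

lemma generated_Un: "generated (A \<union> B) = generated A \<union> generated B"
  unfolding generated_def by blast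

lemma generated_mono_subset: "F \<in> generated S \<Longrightarrow> G \<subseteq> F \<Longrightarrow> G \<in> generated S"
  unfolding generated_def by blast

lemma image_generated: "(\<lambda>F. f ` F) ` generated S = generated ((\<lambda>F. f ` F) ` S)"
  unfolding generated_def by (auto simp: subset_image_iff)

lemma vertices_generated: "vertices (generated S) = \<Union>S"
  unfolding vertices_def generated_def by blast

text \<open>Each face omits an end of both diagonals, so within the four corners it lies in one of
  the sides; closure under subsets supplies the rest.\<close>

lemma induced_four_cycle:
  assumes closed: "\<And>F G. F \<in> \<Delta> \<Longrightarrow> G \<subseteq> F \<Longrightarrow> G \<in> \<Delta>"
    and edges: "{a, b} \<in> \<Delta>" "{b, c} \<in> \<Delta>" "{c, d} \<in> \<Delta>" "{d, a} \<in> \<Delta>"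
    and diagonals: "{a, c} \<notin> \<Delta>" "{b, d} \<notin> \<Delta>"
  shows "isomorphic (induced \<Delta> {a, b, c, d}) four_cycle"
proof -
  \<comment> \<open>If two consecutive corners coincided, a diagonal would be a side; if two
    opposite ones did, a diagonal would be a singleton, which is a face by closure.\<close>
  have distinct: "a \<noteq> b" "a \<noteq> c" "a \<noteq> d" "b \<noteq> c" "b \<noteq> d" "c \<noteq> d"
    using edges diagonals closed[OF edges(1), of "{a}"] closed[OF edges(1), of "{b}"]
    by (auto simp: insert_commute)
  have induced: "induced \<Delta> {a, b, c, d} = generated {{a, b}, {b, c}, {c, d}, {d, a}}"
  proof (intro subset_antisym subsetI)
    fix F assume "F \<in> induced \<Delta> {a, b, c, d}"
    then have F: "F \<in> \<Delta>" "F \<subseteq> {a, b, c, d}"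
      unfolding induced_def by auto
    have "a \<notin> F \<or> c \<notin> F" "b \<notin> F \<or> d \<notin> F"
      using closed[OF F(1), of "{a, c}"] closed[OF F(1), of "{b, d}"] diagonals by auto
    with F(2) have "F \<subseteq> {a, b} \<or> F \<subseteq> {b, c} \<or> F \<subseteq> {c, d} \<or> F \<subseteq> {d, a}"
      by blast
    then show "F \<in> generated {{a, b}, {b, c}, {c, d}, {d, a}}"
      unfolding generated_def by simp
  next
    fix F assume "F \<in> generated {{a, b}, {b, c}, {c, d}, {d, a}}"
    then show "F \<in> induced \<Delta> {a, b, c, d}"
      using edges[THEN closed] unfolding generated_def induced_def by blast
  qed
  \<comment> \<open>Numbers the corners in cyclic order, so that sides go to sides of
    \<open>four_cycle\<close>; the default 3 serves \<open>d\<close>.\<close>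
  define f :: "'a \<Rightarrow> nat" where
    "f = (\<lambda>v. if v = a then 0 else if v = b then 1 else if v = c then 2 else 3)"
  have f: "f a = 0" "f b = 1" "f c = 2" "f d = 3"
    using distinct by (auto simp: f_def)
  have "bij_betw f {b, c, d, a} {1, 2, 3, 0}"
    using distinct unfolding bij_betw_def inj_on_def by (auto simp: f)
  then have "bij_betw f (vertices (induced \<Delta> {a, b, c, d})) (vertices four_cycle)"
    unfolding induced four_cycle_def vertices_generated by (simp add: insert_commute)
  moreover have "(\<lambda>F. f ` F) ` induced \<Delta> {a, b, c, d} = four_cycle"
    unfolding induced four_cycle_def image_generated by (simp add: f)
  ultimately show ?thesis
    unfolding isomorphic_def by blast
qed

text \<open>As \<open>u\<close> is neither \<open>v\<close> nor \<open>w\<close>, the face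
  \<open>{u}\<close> takes nothing from the two points and already lies in \<open>\<Gamma>\<close>,
  where \<open>v\<close> can be joined to it.\<close>

lemma suspension_point_adjacent:
  assumes "\<Delta> = join \<Gamma> (generated {{v}, {w}})" "{u} \<in> \<Delta>" "u \<noteq> v" "u \<noteq> w"
  shows "{v, u} \<in> \<Delta>"
proof -
  obtain F G where FG: "{u} = F \<union> G" "F \<in> \<Gamma>" "G \<subseteq> {v} \<or> G \<subseteq> {w}"
    using assms(1,2) unfolding join_def generated_def by blast
  have "G \<subseteq> {u}"
    using FG(1) by blast
  with FG(3) assms(3,4) have "G = {}"
    by blast
  with FG(1,2) have "{u} \<in> \<Gamma>"
    by simp
  moreover have "{v} \<in> generated {{v}, {w}}"
    unfolding generated_def by blast
  moreover have "{v, u} = {u} \<union> {v}"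
    by blast
  ultimately show ?thesis
    unfolding assms(1) join_def by blast
qed

text \<open>The complement of the 1-skeleton: the 9-cycle \<open>X1 Y1 Z1 X2 Y2 Z2 X3 Y3 Z3\<close>,
  the triangle \<open>V1 V2 V3\<close>, and edges from \<open>V1\<close> to each \<open>Z\<close>,
  from \<open>V2\<close> to each \<open>X\<close> and from \<open>V3\<close> to each
  \<open>Y\<close>.\<close>

fun non_neighbours :: "vertex \<Rightarrow> vertex set" where
  "non_neighbours X1 = {Y1, Z3, V2}"
| "non_neighbours X2 = {Y2, Z1, V2}"
| "non_neighbours X3 = {Y3, Z2, V2}"
| "non_neighbours Y1 = {X1, Z1, V3}"
| "non_neighbours Y2 = {X2, Z2, V3}"
| "non_neighbours Y3 = {X3, Z3, V3}"
| "non_neighbours Z1 = {X2, Y1, V1}"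
| "non_neighbours Z2 = {X3, Y2, V1}"
| "non_neighbours Z3 = {X1, Y3, V1}"
| "non_neighbours V1 = {Z1, Z2, Z3, V2, V3}"
| "non_neighbours V2 = {X1, X2, X3, V1, V3}"
| "non_neighbours V3 = {Y1, Y2, Y3, V1, V2}"

text \<open>Eight sets for each of the three cones, then the nine generators of
  \<open>Gamma2\<close>, with elements in the order in which expanding the joins produces
  them.\<close>

definition facets :: "vertex set set" where
  "facets =
     {{X1, X2, X3, V1}, {X1, X2, Y3, V1}, {X1, Y2, X3, V1}, {X1, Y2, Y3, V1},
      {Y1, X2, X3, V1}, {Y1, X2, Y3, V1}, {Y1, Y2, X3, V1}, {Y1, Y2, Y3, V1},
      {Y1, Y2, Y3, V2}, {Y1, Y2, Z3, V2}, {Y1, Z2, Y3, V2}, {Y1, Z2, Z3, V2},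
      {Z1, Y2, Y3, V2}, {Z1, Y2, Z3, V2}, {Z1, Z2, Y3, V2}, {Z1, Z2, Z3, V2},
      {X1, X2, X3, V3}, {X1, X2, Z2, V3}, {X1, Z1, X3, V3}, {X1, Z1, Z2, V3},
      {Z3, X2, X3, V3}, {Z3, X2, Z2, V3}, {Z3, Z1, X3, V3}, {Z3, Z1, Z2, V3},
      {X1, X2, Y3, Z2}, {X2, Y1, Y3, Z2}, {X2, Y1, Z2, Z3},
      {X2, X3, Y1, Z3}, {X3, Y1, Y2, Z3}, {X3, Y2, Z1, Z3},
      {X1, X3, Y2, Z1}, {X1, Y2, Y3, Z1}, {X1, Y3, Z1, Z2}}"

lemma Delta_12_33_generated: "Delta_12_33 = generated facets"
  unfolding Delta_12_33_def Gamma1_def Gamma2_def cone_def diamond.simps join_generated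
    generated_Un[symmetric] facets_def
  by (simp only: UN_insert UN_empty Union_insert Union_empty image_insert image_empty
    Un_insert_left Un_empty_left Un_empty_right)

lemma Delta_12_33_closed: "F \<in> Delta_12_33 \<Longrightarrow> G \<subseteq> F \<Longrightarrow> G \<in> Delta_12_33"
  unfolding Delta_12_33_generated by (rule generated_mono_subset)

text \<open>A case check over all ordered pairs. The case \<open>a = b\<close> is included and
  yields that every vertex is a face.\<close>

lemma pair_in_Delta_12_33: "{a, b} \<in> Delta_12_33 \<longleftrightarrow> b \<notin> non_neighbours a"
proof -
  have "{a, b} \<in> Delta_12_33 \<longleftrightarrow> (\<exists>G\<in>facets. a \<in> G \<and> b \<in> G)"
    unfolding Delta_12_33_generated generated_def by simp
  then show ?thesis
    unfolding facets_def by (cases a; simp; cases b; simp)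
qed

lemma singleton_in_Delta_12_33: "{a} \<in> Delta_12_33"
  using pair_in_Delta_12_33[of a a] by (cases a) auto

text \<open>Two suffice against a suspension: at most one of \<open>p\<close> and \<open>q\<close>
  is the opposite suspension point, and the other would have to be adjacent to
  \<open>v\<close>.\<close>

lemma ex_two_non_neighbours: "\<exists>p\<in>non_neighbours v. \<exists>q\<in>non_neighbours v. p \<noteq> q \<and> p \<noteq> v \<and> q \<noteq> v"
  by (cases v) auto

lemma Delta_12_33_not_suspension: "\<not> is_suspension Delta_12_33"
proof
  assume "is_suspension Delta_12_33"
  then obtain \<Gamma> v w where "Delta_12_33 = join \<Gamma> (generated {{v}, {w}})"
    unfolding is_suspension_def by blast
  then have "u \<notin> non_neighbours v" if "u \<noteq> v" "u \<noteq> w" for u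
    using suspension_point_adjacent singleton_in_Delta_12_33 pair_in_Delta_12_33 that by metis
  then show False
    using ex_two_non_neighbours by metis
qed

text \<open>In the complement graph, \<open>ac\<close> and \<open>bd\<close> become two disjoint
  edges with no edge between them. Such \<open>c\<close> and \<open>d\<close> are found separately
  for each pair \<open>a\<close>, \<open>b\<close>.\<close>

lemma ex_four_cycle_through_edge:
  assumes "a \<noteq> b" "b \<notin> non_neighbours a"
  shows "\<exists>c\<in>non_neighbours a. \<exists>d\<in>non_neighbours b.
    c \<notin> non_neighbours b \<and> d \<notin> non_neighbours c \<and> a \<notin> non_neighbours d"
  using assms by (cases a; cases b; simp)

lemma Delta_12_33_not_contractible_edge: "\<not> contractible_edge Delta_12_33 e"
proof
  assume e: "contractible_edge Delta_12_33 e"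
  then obtain a b where ab: "e = {a, b}" "a \<noteq> b" "{a, b} \<in> Delta_12_33"
    unfolding contractible_edge_def is_edge_def card_2_iff by blast
  then obtain c d where cd: "{b, c} \<in> Delta_12_33" "{c, d} \<in> Delta_12_33" "{d, a} \<in> Delta_12_33"
      "{a, c} \<notin> Delta_12_33" "{b, d} \<notin> Delta_12_33"
    using ex_four_cycle_through_edge[of a b] unfolding pair_in_Delta_12_33 by blast
  have "isomorphic (induced Delta_12_33 {a, b, c, d}) four_cycle"
    using Delta_12_33_closed ab(3) cd by (rule induced_four_cycle)
  moreover have "{a, b, c, d} \<subseteq> vertices Delta_12_33"
    using singleton_in_Delta_12_33 unfolding vertices_def by blast
  moreover have "e \<in> induced Delta_12_33 {a, b, c, d}"
    using ab unfolding induced_def by blast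
  ultimately show False
    using e unfolding contractible_edge_def by blast
qed

theorem theorem3p6:
  shows "\<not> is_suspension Delta_12_33 \<and> \<not> (\<exists>e. contractible_edge Delta_12_33 e)"
  using Delta_12_33_not_suspension Delta_12_33_not_contractible_edge by blast

end
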